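(* Let $K$ be a field with $\mathrm{char}(K)=0$ and let $n\geq 3$. Let $A=\sigma(K)\langle x_1,\dots,x_n\rangle$ be a skew $PBW$ extension of $K$ defined by $$x_jx_i=q_{ij}x_ix_j+a_{ij}^{(1)}x_1+\cdots+a_{ij}^{(n)}x_n+d_{ij},\qquad 1\leq i<j\leq n,$$ with $q_{ij},a_{ij}^{(k)},d_{ij}\in K$, where $q_{ij}=\frac{l_{ij}}{k_{ij}}$ for nonzero integers $l_{ij},k_{ij}$ with $\gcd(l_{ij},k_{rs})=1$ for all pairs $i<j$ and $r<s$, and $\gcd(l_{ij},l_{rs})=\gcd(k_{ij},k_{rs})=1$ for all distinct pairs $(i,j)\neq(r,s)$ with $i<j$ and $r<s$. If no $q_{ij}$ with $1\le i<j\le n$ is a root of unity, then the center of $A$ is $Z(A)=K$.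
   Context: That $A$ is a skew $PBW$ extension of $K$ with the displayed relations means here: $A$ is a $K$-algebra containing $K$ (so elements of $K$ commute with every $x_i$), generated by $x_1,\dots,x_n$, the stated relations hold in $A$, and the standard monomials $x_1^{\alpha_1}\cdots x_n^{\alpha_n}$, $(\alpha_1,\dots,\alpha_n)\in\mathbb{N}^n$ (with $0\in\mathbb N$), form a $K$-basis of $A$. Since $\mathrm{char}(K)=0$, $\mathbb{Q}\subseteq K$. *)

theory Defs
  imports Complex_Main
begin

locale assoc_algebra = vector_space scale
  for scale :: "'k::field \<Rightarrow> 'a::ring_1 \<Rightarrow> 'a" +
  assumes scale_mult_left: "scale c (a * b) = scale c a * b"
    and scale_mult_right: "scale c (a * b) = a * scale c b"
begin

(* The copy of the ground field inside the algebra. Since 1 \<noteq> 0 holds in ring_1, the map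
   c \<mapsto> c 1 is injective, and by the two compatibility laws its image is central. *)
definition scalars :: "'a set" where
  "scalars = range (\<lambda>c. scale c 1)"

definition subalgebra :: "'a set \<Rightarrow> bool" where
  "subalgebra B \<longleftrightarrow> subspace B \<and> 1 \<in> B \<and> (\<forall>a\<in>B. \<forall>b\<in>B. a * b \<in> B)"

end

definition ring_center :: "'a::ring_1 set" where
  "ring_center = {z. \<forall>a. z * a = a * z}"

definition is_root_of_unity :: "'k::field \<Rightarrow> bool" where
  "is_root_of_unity z \<longleftrightarrow> (\<exists>m::nat. m > 0 \<and> z ^ m = 1)"

(* Elements of \<nat>^n, with indices 1, ..., n; the value is fixed to 0 elsewhere so that
   different functions are different multi-indices. *)
definition multi_indices :: "nat \<Rightarrow> (nat \<Rightarrow> nat) set" where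
  "multi_indices n = {\<alpha>. \<forall>i. i \<notin> {1..n} \<longrightarrow> \<alpha> i = 0}"

(* The ordered product x 1 ^ \<alpha> 1 * ... * x n ^ \<alpha> n. *)
definition std_monomial :: "nat \<Rightarrow> (nat \<Rightarrow> 'a::ring_1) \<Rightarrow> (nat \<Rightarrow> nat) \<Rightarrow> 'a" where
  "std_monomial n x \<alpha> = prod_list (map (\<lambda>i. x i ^ \<alpha> i) [1..<Suc n])"

(* The whole type 'a is the skew PBW extension. The basis condition is for the family of
   standard monomials indexed by multi-indices, hence the injectivity assumption.
   The coefficient of x k in the relation for the pair i < j is a i j k. *)
locale skew_PBW_extension = assoc_algebra scale
  for scale :: "'k::field \<Rightarrow> 'a::ring_1 \<Rightarrow> 'a" +
  fixes n :: nat
    and x :: "nat \<Rightarrow> 'a"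
    and q :: "nat \<Rightarrow> nat \<Rightarrow> 'k"
    and a :: "nat \<Rightarrow> nat \<Rightarrow> nat \<Rightarrow> 'k"
    and d :: "nat \<Rightarrow> nat \<Rightarrow> 'k"
  assumes generated: "subalgebra hull (x ` {1..n}) = UNIV"
    and relation: "\<And>i j. 1 \<le> i \<Longrightarrow> i < j \<Longrightarrow> j \<le> n \<Longrightarrow>
      x j * x i = scale (q i j) (x i * x j) + (\<Sum>k = 1..n. scale (a i j k) (x k)) + scale (d i j) 1"
    and monomials_inj: "inj_on (std_monomial n x) (multi_indices n)"
    and monomials_independent: "independent (std_monomial n x ` multi_indices n)"
    and monomials_span: "span (std_monomial n x ` multi_indices n) = UNIV"

definition index_pairs :: "nat \<Rightarrow> (nat \<times> nat) set" where
  "index_pairs n = {(i, j). 1 \<le> i \<and> i < j \<and> j \<le> n}"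

end

theory Submission
  imports Defs "HOL-Library.Multiset"
begin

text \<open>
  Filter the algebra by the length of words in the generators. Reordering a word only changes it by
  a nonzero factor modulo shorter words, so a combination of standard monomials of degree \<open>> m\<close>
  lies in the \<open>m\<close>-th filtration step only if it is trivial. Comparing \<open>z x\<^sub>i\<close> and
  \<open>x\<^sub>i z\<close> in top degree for central \<open>z\<close> forces the commutation factor of
  \<open>x\<^sub>i\<close> with every leading monomial \<open>x\<^sup>\<alpha>\<close> of \<open>z\<close> to be 1.
  For \<open>i = 1\<close> this factor is the product of the \<open>q\<^sub>1\<^sub>j ^ \<alpha>\<^sub>j\<close> over
  \<open>j \<ge> 2\<close>; by coprimality, any \<open>j\<close> with \<open>\<alpha>\<^sub>j > 0\<close> would have
  \<open>q\<^sub>1\<^sub>j = \<plusminus>1\<close>. Then \<open>i = 2\<close> leaves \<open>q\<^sub>1\<^sub>2 ^ \<alpha>\<^sub>1 = 1\<close>,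
  so \<open>\<alpha> = 0\<close>.
\<close>

locale bijective_skew_PBW_extension = skew_PBW_extension +
  assumes q_nonzero: "\<And>i j. 1 \<le> i \<Longrightarrow> i < j \<Longrightarrow> j \<le> n \<Longrightarrow> q i j \<noteq> 0"
begin

section \<open>Words in the generators and the length filtration\<close>

definition word :: "nat list \<Rightarrow> 'b" where
  "word zs = prod_list (map x zs)"

text \<open>Words with letters in any order are allowed, so that products are handled by
  concatenation. The link to standard monomials is established in
  \<open>filtration_subset_span_mon\<close>.\<close>

definition filtration :: "nat \<Rightarrow> 'b set" where
  "filtration m = span {word zs | zs. set zs \<subseteq> {1..n} \<and> length zs \<le> m}"

definition degree :: "(nat \<Rightarrow> nat) \<Rightarrow> nat" where
  "degree \<alpha> = (\<Sum>i = 1..n. \<alpha> i)"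

definition std_word :: "(nat \<Rightarrow> nat) \<Rightarrow> nat list" where
  "std_word \<alpha> = concat (map (\<lambda>i. replicate (\<alpha> i) i) [1..<Suc n])"

text \<open>\<open>x k * x i\<close> equals \<open>comm_factor k i\<close> times \<open>x i * x k\<close> up to lower-degree terms.\<close>

definition comm_factor :: "nat \<Rightarrow> nat \<Rightarrow> 'a" where
  "comm_factor k i = (if i < k then q i k else if k < i then inverse (q k i) else 1)"

abbreviation mon :: "(nat \<Rightarrow> nat) \<Rightarrow> 'b" where
  "mon \<equiv> std_monomial n x"

lemma word_Nil [simp]: "word [] = 1"
  and word_Cons [simp]: "word (i # zs) = x i * word zs"
  and word_append [simp]: "word (ys @ zs) = word ys * word zs"
  by (simp_all add: word_def)

lemma subspace_filtration: "subspace (filtration m)"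
  by (simp add: filtration_def)

lemma word_in_filtration: "set zs \<subseteq> {1..n} \<Longrightarrow> length zs \<le> m \<Longrightarrow> word zs \<in> filtration m"
  unfolding filtration_def by (rule span_base) auto

lemma filtration_mono: "m \<le> m' \<Longrightarrow> filtration m \<subseteq> filtration m'"
  unfolding filtration_def by (rule span_mono) auto

text \<open>Concatenation adds lengths; linearity, first in \<open>v\<close> and then in
  \<open>u\<close>, extends this from words to their spans.\<close>

lemma filtration_mult:
  assumes "u \<in> filtration m" "v \<in> filtration m'"
  shows "u * v \<in> filtration (m + m')"
proof -
  have word_mult: "word zs * v \<in> filtration (m + m')" if zs: "set zs \<subseteq> {1..n}" "length zs \<le> m" for zs
    using assms(2) unfolding filtration_def[of m']
  proof (induction rule: span_induct)
    \<comment> \<open>\<open>base\<close> asks that the elements satisfying the claim form a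
      subspace; \<open>step\<close> treats a generator of the span.\<close>
    case base
    show ?case
      using subspace_filtration[of "m + m'"]
      by (auto simp: subspace_def distrib_left scale_mult_right[symmetric])
  next
    case (step v)
    then obtain ys where "v = word ys" "set ys \<subseteq> {1..n}" "length ys \<le> m'" by blast
    with zs show ?case by (simp del: word_append add: word_append[symmetric] word_in_filtration)
  qed
  from assms(1) show ?thesis unfolding filtration_def[of m]
  proof (induction rule: span_induct)
    case base
    show ?case
      using subspace_filtration[of "m + m'"]
      by (auto simp: subspace_def distrib_right scale_mult_left[symmetric])
  next
    case (step u)
    with word_mult show ?case by blast
  qed
qed

lemma x_in_filtration: "i \<in> {1..n} \<Longrightarrow> x i \<in> filtration 1"
  using word_in_filtration[of "[i]" 1] by simp

section \<open>Reordering words modulo shorter words\<close>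

lemma relation_filtration:
  assumes "1 \<le> i" "i < j" "j \<le> n"
  shows "x j * x i - scale (q i j) (x i * x j) \<in> filtration 1"
proof -
  have "(\<Sum>k = 1..n. scale (a i j k) (x k)) + scale (d i j) 1 \<in> filtration 1"
    using word_in_filtration[of "[]" 1]
    by (intro subspace_add subspace_sum subspace_scale subspace_filtration x_in_filtration) simp_all
  then show ?thesis using relation[OF assms] by simp
qed

lemma letters_commute:
  assumes "k \<in> {1..n}" "i \<in> {1..n}"
  shows "x k * x i - scale (comm_factor k i) (x i * x k) \<in> filtration 1"
proof (cases k i rule: linorder_cases)
  case less
  then have "q k i \<noteq> 0" using assms q_nonzero by simp
  \<comment> \<open>The defining relation expresses \<open>x i * x k\<close> here, so it is solved
    for \<open>x k * x i\<close> by dividing by \<open>q k i\<close>.\<close>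
  then have "x k * x i - scale (comm_factor k i) (x i * x k) =
      scale (- inverse (q k i)) (x i * x k - scale (q k i) (x k * x i))"
    using less by (simp add: comm_factor_def scale_right_diff_distrib)
  also have "\<dots> \<in> filtration 1"
    using less assms by (intro subspace_scale subspace_filtration relation_filtration) auto
  finally show ?thesis .
next
  case equal
  then show ?thesis using subspace_0[OF subspace_filtration] by (simp add: comm_factor_def)
next
  case greater
  then show ?thesis using assms relation_filtration[of i k] by (simp add: comm_factor_def)
qed

text \<open>The letter \<open>x i\<close> travels from the right end to the left end. Each letter
  passed contributes its commutation factor and an error that is one letter shorter than the whole
  product.\<close>

lemma word_commutes_letter:
  assumes "set zs \<subseteq> {1..n}" "i \<in> {1..n}"
  shows "word zs * x i - scale (prod_list (map (\<lambda>k. comm_factor k i) zs)) (x i * word zs)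
    \<in> filtration (length zs)"
  using assms(1)
proof (induction zs)
  case Nil
  then show ?case using subspace_0[OF subspace_filtration] by simp
next
  case (Cons k zs)
  let ?p = "prod_list (map (\<lambda>k. comm_factor k i) zs)"
  let ?r = "comm_factor k i"
  have k: "k \<in> {1..n}" and zs: "set zs \<subseteq> {1..n}" using Cons.prems by auto
  \<comment> \<open>The first summand moves \<open>x i\<close> past \<open>word zs\<close>, the
    second past \<open>x k\<close>; the intermediate terms \<open>x k * x i * word zs\<close>
    cancel.\<close>
  have "x k * (word zs * x i - scale ?p (x i * word zs))
      + scale ?p ((x k * x i - scale ?r (x i * x k)) * word zs) \<in> filtration (1 + length zs)"
    using assms(2) k zs Cons.IH
    by (intro subspace_add subspace_scale subspace_filtration filtration_mult letters_commute
        x_in_filtration word_in_filtration) simp_all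
  also have "x k * (word zs * x i - scale ?p (x i * word zs))
      + scale ?p ((x k * x i - scale ?r (x i * x k)) * word zs)
      = word (k # zs) * x i - scale (?r * ?p) (x i * word (k # zs))"
    by (simp add: algebra_simps scale_right_diff_distrib scale_mult_left[symmetric]
        scale_mult_right[symmetric])
  finally show ?case by simp
qed

text \<open>Following the recursion of \<open>insort\<close>, \<open>x i\<close> moves right past
  smaller letters only. The scalar \<open>s\<close> is the product of the factors met on the way;
  later arguments use only that it is nonzero.\<close>

lemma letter_word_insort:
  assumes "set zs \<subseteq> {1..n}" "i \<in> {1..n}"
  obtains s where "s \<noteq> 0" "x i * word zs - scale s (word (insort i zs)) \<in> filtration (length zs)"
proof -
  have "\<exists>s. s \<noteq> 0 \<and> x i * word zs - scale s (word (insort i zs)) \<in> filtration (length zs)"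
    using assms(1)
  proof (induction zs)
    case Nil
    show ?case using subspace_0[OF subspace_filtration] by (intro exI[of _ 1]) simp
  next
    case (Cons y zs)
    have y: "y \<in> {1..n}" and zs: "set zs \<subseteq> {1..n}" using Cons.prems by auto
    show ?case
    proof (cases "i \<le> y")
      case True
      then show ?thesis using subspace_0[OF subspace_filtration] by (intro exI[of _ 1]) simp
    next
      case False
      let ?r = "comm_factor i y"
      obtain s where s: "s \<noteq> 0"
          "x i * word zs - scale s (word (insort i zs)) \<in> filtration (length zs)"
        using Cons.IH zs by blast
      have "?r \<noteq> 0" using False assms(2) y q_nonzero by (simp add: comm_factor_def)
      \<comment> \<open>First \<open>x i\<close> is moved past \<open>x y\<close>, then inserted
        into the remaining word; again the intermediate terms cancel.\<close>
      have "(x i * x y - scale ?r (x y * x i)) * word zs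
          + scale ?r (x y * (x i * word zs - scale s (word (insort i zs))))
          \<in> filtration (1 + length zs)"
        using assms(2) y zs s
        by (intro subspace_add subspace_scale subspace_filtration filtration_mult letters_commute
            x_in_filtration word_in_filtration) simp_all
      also have "(x i * x y - scale ?r (x y * x i)) * word zs
          + scale ?r (x y * (x i * word zs - scale s (word (insort i zs))))
          = x i * word (y # zs) - scale (?r * s) (word (insort i (y # zs)))"
        using False
        by (simp add: algebra_simps scale_right_diff_distrib scale_mult_left[symmetric]
            scale_mult_right[symmetric])
      finally show ?thesis using s(1) \<open>?r \<noteq> 0\<close> by (intro exI[of _ "?r * s"]) simp
    qed
  qed
  then show thesis using that by blast
qed

section \<open>Standard monomials as sorted words\<close>

lemma set_std_word: "set (std_word \<alpha>) \<subseteq> {1..n}"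
  by (auto simp: std_word_def)

lemma prod_list_std_word:
  fixes f :: "nat \<Rightarrow> 'c::comm_monoid_mult"
  shows "prod_list (map f (std_word \<alpha>)) = (\<Prod>i = 1..n. f i ^ \<alpha> i)"
proof -
  have "prod_list (map f (concat (map (\<lambda>i. replicate (\<alpha> i) i) [1..<Suc m]))) = (\<Prod>i = 1..m. f i ^ \<alpha> i)" for m
    by (induction m) (simp_all add: prod_list_replicate mult.commute)
  then show ?thesis by (simp add: std_word_def)
qed

lemma length_std_word: "length (std_word \<alpha>) = degree \<alpha>"
  by (simp add: std_word_def degree_def length_concat comp_def interv_sum_list_conv_sum_set_nat
      atLeastLessThanSuc_atLeastAtMost del: upt_Suc)

lemma word_std_word: "word (std_word \<alpha>) = mon \<alpha>"
proof -
  have "word (concat (map (\<lambda>i. replicate (\<alpha> i) i) js)) = prod_list (map (\<lambda>i. x i ^ \<alpha> i) js)" for js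
    by (induction js) (simp_all, simp add: word_def prod_list_replicate)
  then show ?thesis by (simp add: std_word_def std_monomial_def)
qed

lemma sorted_std_word: "sorted (std_word \<alpha>)"
proof -
  have "sorted (concat (map (\<lambda>i. replicate (\<alpha> i) i) [1..<m]))" for m
    by (induction m) (auto simp: sorted_append)
  then show ?thesis by (simp add: std_word_def del: upt_Suc)
qed

lemma count_std_word:
  assumes "\<alpha> \<in> multi_indices n"
  shows "count (mset (std_word \<alpha>)) = \<alpha>"
proof
  fix j
  have "count (mset (concat (map (\<lambda>i. replicate (\<alpha> i) i) [1..<Suc m]))) j =
      (if j \<in> {1..m} then \<alpha> j else 0)" for m
    by (induction m) (auto simp: le_Suc_eq)
  then show "count (mset (std_word \<alpha>)) j = \<alpha> j"
    using assms by (auto simp: std_word_def multi_indices_def simp del: upt_Suc)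
qed

lemma count_multi_index: "set zs \<subseteq> {1..n} \<Longrightarrow> count (mset zs) \<in> multi_indices n"
  by (auto simp: multi_indices_def count_eq_zero_iff)

text \<open>A sorted list is determined by its multiset, so counting letters inverts
  \<open>std_word\<close> on sorted lists.\<close>

lemma sorted_eq_std_word:
  assumes "sorted zs" "set zs \<subseteq> {1..n}"
  shows "zs = std_word (count (mset zs))"
proof -
  have "mset zs = mset (std_word (count (mset zs)))"
    using count_std_word[OF count_multi_index[OF assms(2)]] by (metis multiset_eqI)
  then show ?thesis using assms(1) sorted_std_word by (metis properties_for_sort sorted_sort_id)
qed

section \<open>The filtration in terms of the standard basis\<close>

text \<open>\<open>monomials_span\<close> gives no control of degrees. The bound comes from
  induction on \<open>m\<close>: a nonempty word is a letter times a shorter word, the latter is a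
  combination of monomials by induction, and inserting the letter leaves an error in
  \<open>filtration m\<close>, which the induction hypothesis covers as well.\<close>

lemma filtration_subset_span_mon:
  "filtration m \<subseteq> span (mon ` {\<alpha> \<in> multi_indices n. degree \<alpha> \<le> m})"
proof (induction m)
  let ?S = "\<lambda>m. mon ` {\<alpha> \<in> multi_indices n. degree \<alpha> \<le> m}"
  have sorted_word: "word zs \<in> span (?S m)" if "sorted zs" "set zs \<subseteq> {1..n}" "length zs \<le> m" for m zs
  proof (rule span_base)
    have "word zs = mon (count (mset zs))" using sorted_eq_std_word[OF that(1,2)] word_std_word by metis
    moreover have "degree (count (mset zs)) = length zs"
      using sorted_eq_std_word[OF that(1,2)] length_std_word by metis
    ultimately show "word zs \<in> ?S m" using that count_multi_index by auto
  qed
  {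
    case 0
    show ?case unfolding filtration_def using sorted_word[of "[]" 0]
      by (intro span_minimal) auto
  next
    case (Suc m)
    have mono: "span (?S m) \<subseteq> span (?S (Suc m))" by (rule span_mono) auto
    have letter: "x i * u \<in> span (?S (Suc m))" if u: "u \<in> filtration m" and i: "i \<in> {1..n}" for i u
    proof -
      from u Suc.IH have "u \<in> span (?S m)" by blast
      then show ?thesis
      proof (induction rule: span_induct)
        case base
        show ?case using subspace_span[of "?S (Suc m)"]
          by (auto simp: subspace_def distrib_left scale_mult_right[symmetric])
      next
        case (step u)
        then obtain \<alpha> where \<alpha>: "\<alpha> \<in> multi_indices n" "degree \<alpha> \<le> m" and u_eq: "u = mon \<alpha>" by auto
        obtain s where "x i * word (std_word \<alpha>) - scale s (word (insort i (std_word \<alpha>)))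
            \<in> filtration (length (std_word \<alpha>))"
          using letter_word_insort[OF set_std_word i] by blast
        then have "x i * u - scale s (word (insort i (std_word \<alpha>))) \<in> filtration m"
          using filtration_mono[OF \<alpha>(2)] by (auto simp: word_std_word u_eq length_std_word)
        then have "x i * u - scale s (word (insort i (std_word \<alpha>))) \<in> span (?S (Suc m))"
          using Suc.IH mono by blast
        moreover have "scale s (word (insort i (std_word \<alpha>))) \<in> span (?S (Suc m))"
          using \<alpha>(2) i set_std_word[of \<alpha>]
          by (intro span_scale sorted_word)
            (simp_all add: sorted_insort sorted_std_word set_insort_key length_std_word)
        ultimately show ?case using span_add by fastforce
      qed
    qed
    show ?case unfolding filtration_def[of "Suc m"]
    proof (intro span_minimal subspace_span subsetI)
      fix w assume "w \<in> {word zs |zs. set zs \<subseteq> {1..n} \<and> length zs \<le> Suc m}"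
      then obtain zs where w: "w = word zs" and zs: "set zs \<subseteq> {1..n}" "length zs \<le> Suc m" by blast
      show "w \<in> span (?S (Suc m))"
      proof (cases zs)
        case Nil
        then show ?thesis using sorted_word[of zs "Suc m"] by (simp add: w)
      next
        case (Cons i ys)
        then show ?thesis using zs letter[OF word_in_filtration[of ys m], of i] by (simp add: w)
      qed
    qed
  }
qed

text \<open>The coordinate of the sum at \<open>mon \<beta>\<close> is \<open>f \<beta>\<close>,
  while an element of \<open>filtration m\<close> has nonzero coordinates only at monomials of
  degree at most \<open>m\<close>.\<close>

lemma mon_independent_mod_filtration:
  assumes "finite U" "U \<subseteq> multi_indices n" "\<And>\<alpha>. \<alpha> \<in> U \<Longrightarrow> m < degree \<alpha>"
    and "(\<Sum>\<alpha>\<in>U. scale (f \<alpha>) (mon \<alpha>)) \<in> filtration m" and "\<beta> \<in> U"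
  shows "f \<beta> = 0"
proof -
  let ?B = "mon ` multi_indices n" and ?S = "mon ` {\<alpha> \<in> multi_indices n. degree \<alpha> \<le> m}"
  let ?v = "\<Sum>\<alpha>\<in>U. scale (f \<alpha>) (mon \<alpha>)"
  have \<beta>: "\<beta> \<in> multi_indices n" using assms(2,5) by blast
  have "representation ?B ?v (mon \<beta>) = (\<Sum>\<alpha>\<in>U. f \<alpha> * representation ?B (mon \<alpha>) (mon \<beta>))"
    using monomials_independent monomials_span
    by (simp add: representation_sum representation_scale)
  also have "\<dots> = (\<Sum>\<alpha>\<in>U. if \<alpha> = \<beta> then f \<alpha> else 0)"
  proof (rule sum.cong)
    fix \<alpha> assume "\<alpha> \<in> U"
    then have \<alpha>: "\<alpha> \<in> multi_indices n" using assms(2) by blast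
    then show "f \<alpha> * representation ?B (mon \<alpha>) (mon \<beta>) = (if \<alpha> = \<beta> then f \<alpha> else 0)"
      using \<beta> inj_onD[OF monomials_inj, of \<alpha> \<beta>]
      by (auto simp: representation_basis[OF monomials_independent])
  qed simp
  also have "\<dots> = f \<beta>" using assms(1,5) by simp
  finally have "representation ?B ?v (mon \<beta>) = f \<beta>" .
  \<comment> \<open>Since \<open>?v\<close> lies in the span of the subset \<open>?S\<close> of the
    basis, its coordinates in \<open>?B\<close> are those in \<open>?S\<close>, extended by
    zero.\<close>
  moreover have "representation ?B ?v = representation ?S ?v"
    using assms(4) filtration_subset_span_mon[of m]
    by (intro representation_extend monomials_independent) auto
  moreover have "mon \<beta> \<notin> ?S"
    using \<beta> assms(3)[OF assms(5)] inj_onD[OF monomials_inj] by fastforce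
  ultimately show ?thesis using representation_ne_zero[of ?S ?v "mon \<beta>"] by auto
qed

section \<open>Leading exponents of central elements\<close>

text \<open>Modulo \<open>filtration m\<close>, the commutator of \<open>z\<close> with
  \<open>x i\<close> is a combination of monomials of degree \<open>Suc m\<close> with distinct
  exponents. It vanishes, so each coefficient
  \<open>c \<alpha> * ((p \<alpha> - 1) * s \<alpha>)\<close> is zero, and at \<open>\<beta>\<close>
  only the middle factor can vanish.\<close>

lemma center_leading_exponent:
  assumes z: "z \<in> ring_center" "z = (\<Sum>\<alpha>\<in>T. scale (c \<alpha>) (mon \<alpha>))"
    and T: "finite T" "T \<subseteq> multi_indices n" "\<And>\<alpha>. \<alpha> \<in> T \<Longrightarrow> degree \<alpha> \<le> m"
    and \<beta>: "\<beta> \<in> T" "degree \<beta> = m" "c \<beta> \<noteq> 0" and i: "i \<in> {1..n}"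
  shows "(\<Prod>k = 1..n. comm_factor k i ^ \<beta> k) = 1"
proof -
  define p where "p \<alpha> = (\<Prod>k = 1..n. comm_factor k i ^ \<alpha> k)" for \<alpha> :: "nat \<Rightarrow> nat"
  \<comment> \<open>Raises the exponent at \<open>i\<close> by one. The form via
    \<open>insort\<close> makes \<open>mon (inc \<alpha>)\<close> the monomial produced by
    \<open>letter_word_insort\<close>.\<close>
  define inc where "inc \<alpha> = count (mset (insort i (std_word \<alpha>)))" for \<alpha>
  have inc: "inc \<alpha> = \<alpha>(i := Suc (\<alpha> i))" if "\<alpha> \<in> multi_indices n" for \<alpha>
    using count_std_word[OF that] by (auto simp: inc_def)
  have inc_word: "std_word (inc \<alpha>) = insort i (std_word \<alpha>)" for \<alpha>
    unfolding inc_def using i set_std_word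
    by (intro sorted_eq_std_word[symmetric]) (auto simp: sorted_insort sorted_std_word set_insort_key)
  have inc_multi: "inc \<alpha> \<in> multi_indices n" for \<alpha>
    unfolding inc_def using i set_std_word
    by (intro count_multi_index) (auto simp: set_insort_key)
  have inc_degree: "degree (inc \<alpha>) = Suc (degree \<alpha>)" for \<alpha>
    by (simp add: length_std_word[symmetric] inc_word)
  have "\<exists>s. s \<noteq> 0 \<and> x i * mon \<alpha> - scale s (mon (inc \<alpha>)) \<in> filtration (degree \<alpha>)" for \<alpha>
    using letter_word_insort[OF set_std_word i, of \<alpha>]
    by (metis word_std_word inc_word length_std_word)
  then obtain s where s: "\<And>\<alpha>. s \<alpha> \<noteq> 0"
    "\<And>\<alpha>. x i * mon \<alpha> - scale (s \<alpha>) (mon (inc \<alpha>)) \<in> filtration (degree \<alpha>)"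
    by metis
  have comm: "mon \<alpha> * x i - scale (p \<alpha>) (x i * mon \<alpha>) \<in> filtration (degree \<alpha>)" for \<alpha>
    using word_commutes_letter[OF set_std_word i, of \<alpha>]
    by (simp add: word_std_word length_std_word p_def prod_list_std_word)
  define U where "U = {\<alpha> \<in> T. degree \<alpha> = m}"
  define g where "g \<alpha> = c \<alpha> * ((p \<alpha> - 1) * s \<alpha>)" for \<alpha>
  \<comment> \<open>The commutator splits as (\<open>mon \<alpha> * x i\<close> minus
    \<open>p \<alpha>\<close> times \<open>x i * mon \<alpha>\<close>) plus
    \<open>p \<alpha> - 1\<close> times \<open>x i * mon \<alpha>\<close>; the second part is then
    reordered.\<close>
  have top: "scale (c \<alpha>) (mon \<alpha> * x i - x i * mon \<alpha>) - scale (g \<alpha>) (mon (inc \<alpha>)) \<in> filtration m"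
    if "\<alpha> \<in> U" for \<alpha>
  proof -
    have "degree \<alpha> = m" using that by (simp add: U_def)
    then have "scale (c \<alpha>) ((mon \<alpha> * x i - scale (p \<alpha>) (x i * mon \<alpha>))
        + scale (p \<alpha> - 1) (x i * mon \<alpha> - scale (s \<alpha>) (mon (inc \<alpha>)))) \<in> filtration m"
      using comm[of \<alpha>] s(2)[of \<alpha>] by (intro subspace_scale subspace_add subspace_filtration) auto
    also have "scale (c \<alpha>) ((mon \<alpha> * x i - scale (p \<alpha>) (x i * mon \<alpha>))
        + scale (p \<alpha> - 1) (x i * mon \<alpha> - scale (s \<alpha>) (mon (inc \<alpha>))))
        = scale (c \<alpha>) (mon \<alpha> * x i - x i * mon \<alpha>) - scale (g \<alpha>) (mon (inc \<alpha>))"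
      by (simp add: g_def scale_right_diff_distrib scale_left_diff_distrib scale_right_distrib
          left_diff_distrib right_diff_distrib)
    finally show ?thesis .
  qed
  \<comment> \<open>These monomials have degree below \<open>m\<close>, so multiplying by one letter
    stays within \<open>filtration m\<close>.\<close>
  have low: "scale (c \<alpha>) (mon \<alpha> * x i - x i * mon \<alpha>) \<in> filtration m" if "\<alpha> \<in> T - U" for \<alpha>
  proof -
    have "Suc (degree \<alpha>) \<le> m" using that T(3)[of \<alpha>] by (auto simp: U_def)
    moreover have "mon \<alpha> \<in> filtration (degree \<alpha>)"
      using word_in_filtration[OF set_std_word, of \<alpha> "degree \<alpha>"]
      by (simp add: word_std_word length_std_word)
    then have "mon \<alpha> * x i \<in> filtration (Suc (degree \<alpha>))" "x i * mon \<alpha> \<in> filtration (Suc (degree \<alpha>))"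
      using filtration_mult[OF _ x_in_filtration[OF i], of "mon \<alpha>"]
        filtration_mult[OF x_in_filtration[OF i], of "mon \<alpha>"] by fastforce+
    ultimately have "mon \<alpha> * x i \<in> filtration m" "x i * mon \<alpha> \<in> filtration m"
      using filtration_mono by blast+
    then show ?thesis by (intro subspace_scale subspace_diff subspace_filtration)
  qed
  have "0 = z * x i - x i * z" using z(1) by (simp add: ring_center_def)
  also have "\<dots> = (\<Sum>\<alpha>\<in>T. scale (c \<alpha>) (mon \<alpha> * x i - x i * mon \<alpha>))"
    by (simp add: z(2) sum_distrib_right sum_distrib_left sum_subtractf scale_right_diff_distrib
        scale_mult_left[symmetric] scale_mult_right[symmetric])
  also have "\<dots> = (\<Sum>\<alpha>\<in>T - U. scale (c \<alpha>) (mon \<alpha> * x i - x i * mon \<alpha>))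
      + (\<Sum>\<alpha>\<in>U. scale (c \<alpha>) (mon \<alpha> * x i - x i * mon \<alpha>))"
    using T(1) by (intro sum.subset_diff) (auto simp: U_def)
  finally have "(\<Sum>\<alpha>\<in>U. scale (g \<alpha>) (mon (inc \<alpha>))) =
      - ((\<Sum>\<alpha>\<in>T - U. scale (c \<alpha>) (mon \<alpha> * x i - x i * mon \<alpha>))
      + (\<Sum>\<alpha>\<in>U. scale (c \<alpha>) (mon \<alpha> * x i - x i * mon \<alpha>) - scale (g \<alpha>) (mon (inc \<alpha>))))"
    by (simp add: sum_subtractf add_eq_0_iff)
  also have "\<dots> \<in> filtration m"
    using top low by (intro subspace_neg subspace_add subspace_sum subspace_filtration)
  finally have mem: "(\<Sum>\<alpha>\<in>U. scale (g \<alpha>) (mon (inc \<alpha>))) \<in> filtration m" .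
  have inj: "inj_on inc U"
  proof (rule inj_onI)
    fix \<alpha> \<gamma> assume eq: "inc \<alpha> = inc \<gamma>" and "\<alpha> \<in> U" "\<gamma> \<in> U"
    then have "\<alpha> \<in> multi_indices n" "\<gamma> \<in> multi_indices n" using T(2) by (auto simp: U_def)
    then have "\<alpha>(i := Suc (\<alpha> i)) = \<gamma>(i := Suc (\<gamma> i))" using eq by (simp only: inc)
    then show "\<alpha> = \<gamma>" by (metis fun_upd_apply fun_upd_triv fun_upd_upd nat.inject)
  qed
  \<comment> \<open>Independence needs coefficients indexed by the raised exponents, so
    \<open>g\<close> is transported along the injection \<open>inc\<close>.\<close>
  have "(g \<circ> the_inv_into U inc) (inc \<beta>) = 0"
  proof (rule mon_independent_mod_filtration[where U = "inc ` U" and m = m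
        and f = "g \<circ> the_inv_into U inc"])
    show "finite (inc ` U)" using T(1) by (simp add: U_def)
    show "(\<Sum>\<alpha>\<in>inc ` U. scale ((g \<circ> the_inv_into U inc) \<alpha>) (mon \<alpha>)) \<in> filtration m"
      using mem inj by (simp add: sum.reindex the_inv_into_f_f)
  qed (use inc_multi inc_degree \<beta> in \<open>auto simp: U_def\<close>)
  then have "g \<beta> = 0" using inj \<beta> by (simp add: the_inv_into_f_f U_def)
  then show ?thesis using \<beta>(3) s(1)[of \<beta>] by (simp add: g_def p_def)
qed

lemma scalars_subset_center: "scalars \<subseteq> ring_center"
  by (auto simp: scalars_def ring_center_def scale_mult_left[symmetric] scale_mult_right[symmetric])

text \<open>Reduces the computation of the center to a condition on exponents: a leading exponent of
  a central element satisfies all product equations, hence is zero, so every monomial that occurs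
  has degree 0.\<close>

lemma center_eq_scalars:
  assumes trivial: "\<And>\<alpha>. \<alpha> \<in> multi_indices n \<Longrightarrow>
    (\<And>i. i \<in> {1..n} \<Longrightarrow> (\<Prod>k = 1..n. comm_factor k i ^ \<alpha> k) = 1) \<Longrightarrow> \<alpha> = (\<lambda>_. 0)"
  shows "ring_center = scalars"
proof (rule antisym[OF subsetI scalars_subset_center])
  fix z :: 'b assume z: "z \<in> ring_center"
  let ?B = "mon ` multi_indices n"
  define c where "c \<alpha> = representation ?B z (mon \<alpha>)" for \<alpha>
  define T where "T = {\<alpha> \<in> multi_indices n. c \<alpha> \<noteq> 0}"
  have inj: "inj_on mon T" by (rule inj_on_subset[OF monomials_inj]) (auto simp: T_def)
  have image: "mon ` T = {b. representation ?B z b \<noteq> 0}"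
    using representation_ne_zero[of ?B z] by (auto simp: T_def c_def)
  have fin: "finite T"
    using finite_representation[of ?B z] finite_imageD[OF _ inj] by (simp add: image)
  have "z = (\<Sum>b\<in>mon ` T. scale (representation ?B z b) b)"
    unfolding image using monomials_independent monomials_span
    by (simp add: sum_nonzero_representation_eq)
  then have sum: "z = (\<Sum>\<alpha>\<in>T. scale (c \<alpha>) (mon \<alpha>))"
    using inj by (simp add: sum.reindex c_def)
  have deg: "degree \<alpha> = 0" if "\<alpha> \<in> T" for \<alpha>
  proof -
    have "Max (degree ` T) \<in> degree ` T" using fin that by (intro Max_in) auto
    then obtain \<beta> where \<beta>: "\<beta> \<in> T" "degree \<beta> = Max (degree ` T)" by auto
    have "\<beta> = (\<lambda>_. 0)"
      using \<beta> fin
      by (intro trivial center_leading_exponent[OF z sum fin, of "degree \<beta>"]) (auto simp: T_def)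
    then have "Max (degree ` T) = 0" using \<beta>(2) by (simp add: degree_def)
    then show ?thesis using that fin by (metis Max_ge finite_imageI imageI le_zero_eq)
  qed
  have "mon \<alpha> = 1" if "\<alpha> \<in> T" for \<alpha>
    using deg[OF that] by (metis length_std_word length_0_conv word_std_word word_Nil)
  \<comment> \<open>This also covers \<open>z = 0\<close>, where \<open>T\<close> is empty and the
    scalar is the empty sum.\<close>
  then have "z = scale (\<Sum>\<alpha>\<in>T. c \<alpha>) 1" by (subst sum) (simp add: scale_sum_left)
  then show "z \<in> scalars" by (auto simp: scalars_def)
qed

end

section \<open>Multiplicative independence of coprime fractions\<close>

text \<open>In characteristic 0 the equation becomes an equality of integers \<open>?L = ?K\<close>.
  Now \<open>l j\<close> divides \<open>?L\<close> but is coprime to \<open>?K\<close>, hence is a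
  unit, and symmetrically for \<open>k j\<close>. The fraction is therefore 1 or -1.\<close>

lemma coprime_fractions_prod_eq_1:
  fixes l k :: "'i \<Rightarrow> int" and e :: "'i \<Rightarrow> nat"
  assumes "finite J" and "\<And>i. i \<in> J \<Longrightarrow> k i \<noteq> 0"
    and coprime: "\<And>i j. i \<in> J \<Longrightarrow> j \<in> J \<Longrightarrow> coprime (l i) (k j)"
    and prod: "(\<Prod>i\<in>J. (of_int (l i) / of_int (k i) :: 'k::field_char_0) ^ e i) = 1"
    and j: "j \<in> J" "e j > 0"
  shows "is_root_of_unity (of_int (l j) / of_int (k j) :: 'k)"
proof -
  let ?L = "\<Prod>i\<in>J. l i ^ e i" and ?K = "\<Prod>i\<in>J. k i ^ e i"
  have "(of_int ?L :: 'k) / of_int ?K = 1"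
    using prod by (simp add: power_divide prod_dividef)
  then have "(of_int ?L :: 'k) = of_int ?K" by (metis divide_eq_1_iff)
  then have LK: "?L = ?K" by (simp only: of_int_eq_iff)
  have "l j dvd ?L" "k j dvd ?K"
    using assms(1) j by (meson dvd_power dvd_prodI dvd_trans)+
  moreover have "coprime (l j) ?K" "coprime ?L (k j)"
    using j(1) coprime by (auto intro!: prod_coprime_right prod_coprime_left)
  ultimately have "is_unit (l j)" "is_unit (k j)"
    using LK by (metis coprime_absorb_left coprime_absorb_right)+
  then have "l j * l j = 1" "k j * k j = 1"
    by (auto simp: zdvd1_eq abs_if split: if_splits)
  then have "(of_int (l j) / of_int (k j) :: 'k) ^ 2 = of_int 1 / of_int 1"
    by (simp only: power2_eq_square times_divide_times_eq of_int_mult[symmetric])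
  then show ?thesis unfolding is_root_of_unity_def by (intro exI[of _ 2]) simp
qed

theorem theorem2p5:
  fixes scale :: "'k::field_char_0 \<Rightarrow> 'a::ring_1 \<Rightarrow> 'a"
    and n :: nat
    and x :: "nat \<Rightarrow> 'a"
    and q :: "nat \<Rightarrow> nat \<Rightarrow> 'k"
    and a :: "nat \<Rightarrow> nat \<Rightarrow> nat \<Rightarrow> 'k"
    and d :: "nat \<Rightarrow> nat \<Rightarrow> 'k"
    and l k :: "nat \<Rightarrow> nat \<Rightarrow> int"
  assumes "n \<ge> 3"
    and "skew_PBW_extension scale n x q a d"
    and "\<And>i j. (i, j) \<in> index_pairs n \<Longrightarrow> l i j \<noteq> 0"
    and "\<And>i j. (i, j) \<in> index_pairs n \<Longrightarrow> k i j \<noteq> 0"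
    and "\<And>i j. (i, j) \<in> index_pairs n \<Longrightarrow> q i j = of_int (l i j) / of_int (k i j)"
    and "\<And>i j r s. (i, j) \<in> index_pairs n \<Longrightarrow> (r, s) \<in> index_pairs n \<Longrightarrow>
           gcd (l i j) (k r s) = 1"
    and "\<And>i j r s. (i, j) \<in> index_pairs n \<Longrightarrow> (r, s) \<in> index_pairs n \<Longrightarrow> (i, j) \<noteq> (r, s) \<Longrightarrow>
           gcd (l i j) (l r s) = 1"
    and "\<And>i j r s. (i, j) \<in> index_pairs n \<Longrightarrow> (r, s) \<in> index_pairs n \<Longrightarrow> (i, j) \<noteq> (r, s) \<Longrightarrow>
           gcd (k i j) (k r s) = 1"
    and "\<And>i j. (i, j) \<in> index_pairs n \<Longrightarrow> \<not> is_root_of_unity (q i j)"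
  shows "ring_center = assoc_algebra.scalars scale"
proof -
  note nonzero = assms(3,4) and q_eq = assms(5) and coprime = assms(6)
    and not_root = assms(9)
  interpret skew_PBW_extension scale n x q a d by (rule assms(2))
  \<comment> \<open>In characteristic 0, nonzero integers \<open>l i j\<close> and
    \<open>k i j\<close> stay nonzero in the field, so each \<open>q i j\<close> is nonzero.\<close>
  interpret bijective_skew_PBW_extension scale n x q a d
    by unfold_locales (use nonzero q_eq in \<open>auto simp: index_pairs_def\<close>)
  show ?thesis
  proof (rule center_eq_scalars)
    fix \<alpha>
    assume \<alpha>: "\<alpha> \<in> multi_indices n"
      and comm: "\<And>i. i \<in> {1..n} \<Longrightarrow> (\<Prod>k = 1..n. comm_factor k i ^ \<alpha> k) = 1"
    have pair: "(1, j) \<in> index_pairs n" if "j \<in> {2..n}" for j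
      using that by (auto simp: index_pairs_def)
    have split_first: "{1..n} = insert 1 {2..n}" using assms(1) by auto
    \<comment> \<open>\<open>comm_factor j 1\<close> is \<open>q 1 j\<close> for \<open>j\<close> at
      least 2, and the factor at index 1 is 1, so centrality against \<open>x 1\<close> involves
      only the indices from 2 on.\<close>
    have "(\<Prod>j\<in>{2..n}. (of_int (l 1 j) / of_int (k 1 j)) ^ \<alpha> j) = (\<Prod>j\<in>{2..n}. comm_factor j 1 ^ \<alpha> j)"
      using q_eq[OF pair] by (intro prod.cong) (auto simp: comm_factor_def)
    also have "\<dots> = 1" using comm[of 1] assms(1) unfolding split_first by (simp add: comm_factor_def)
    finally have prod: "(\<Prod>j\<in>{2..n}. (of_int (l 1 j) / of_int (k 1 j) :: 'k) ^ \<alpha> j) = 1" .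
    have high: "\<alpha> j = 0" if j: "j \<in> {2..n}" for j
    proof (rule ccontr)
      assume "\<alpha> j \<noteq> 0"
      then have "is_root_of_unity (of_int (l 1 j) / of_int (k 1 j) :: 'k)"
        using nonzero(2)[OF pair] coprime[OF pair pair] j
        by (intro coprime_fractions_prod_eq_1[OF _ _ _ prod]) (auto simp: coprime_iff_gcd_eq_1)
      then show False using not_root[OF pair[OF j]] q_eq[OF pair[OF j]] by simp
    qed
    have "(\<Prod>j = 1..n. comm_factor j 2 ^ \<alpha> j) = comm_factor 1 2 ^ \<alpha> 1"
      unfolding split_first using high by simp
    \<comment> \<open>The surviving factor \<open>comm_factor 1 2\<close> is
      \<open>inverse (q 1 2)\<close>; a power of it equals 1 only if the same power of
      \<open>q 1 2\<close> does.\<close>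
    then have "q 1 2 ^ \<alpha> 1 = 1"
      using comm[of 2] assms(1) by (simp add: comm_factor_def power_inverse)
    moreover have "\<not> is_root_of_unity (q 1 2)"
      using not_root[OF pair] assms(1) by simp
    ultimately have "\<alpha> 1 = 0" by (auto simp: is_root_of_unity_def)
    then have "\<alpha> j = 0" for j
      using high \<alpha> split_first by (cases "j \<in> {1..n}") (auto simp: multi_indices_def)
    then show "\<alpha> = (\<lambda>_. 0)" by blast
  qed
qed

end
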